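(* (i) Whenever equilibria exist in the scenarios (TLC) and (CS), the equilibrium utility for workers in the scenario (CS) is equal to that in the scenario (TLC), i.e. $\rho^{\mathrm{CS}}=\rho^{\mathrm{TLC}}$. (ii) The total commuting cost in the scenario (CS) may be higher than that in the scenario (TLC): there exist parameter values for which equilibria exist in the scenarios (TLC) and (CS) and $TC^{\mathrm{CS}}>TC^{\mathrm{TLC}}$.
   Context: Setting. There are locations $1,\dots,I$, indexed by increasing distance from a central business district (CBD). Location $i$ has land area $A_i>0$; each worker consumes one unit of land and there are $\sum_i A_i$ workers in total, so exactly $A_i$ workers live at $i$. Bottleneck capacities satisfy $\mu_1>\dots>\mu_I>0$; put $\mu_{I+1}=0$ and $\bar\mu_i=\mu_i-\mu_{i+1}$. Free-flow travel times are $f_i\ge 0$. Daily wages for office and remote work are $\theta^O>\theta^R$. The schedule delay cost for preferred arrival time $t_k$ is $\beta(t_k-t)$ if $t<t_k$ and $\gamma(t-t_k)$ if $t\ge t_k$, with $0<\beta<1$, $\gamma>0$ and $\gamma<\bar\mu_i/\mu_{i+1}$ for $i<I$; put $\delta=\beta\gamma/(\beta+\gamma)$. Let $K\in\{1,2\}$ be the number of preferred arrival times; for $K=2$ let $d=t_2-t_1>0$. If $X>0$ commuters use capacity $\mu$, the resulting short-term equilibrium commuting cost per trip (excluding free-flow time) is $\bar c_K(X,\mu)=\frac{X}{\mu}\delta-d(K-1)\delta$. Equilibrium. Given a set $\mathcal H\subseteq[0,1]$ of office work ratios and $K$, an equilibrium consists of an index $i^*\in\{1,\dots,I\}$, office work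 ratios $\eta(i)\in\mathcal H$ (all workers at $i$ choose $\eta(i)$), land rents $r_i\ge0$ with $r_I=0$, costs $\kappa_i$, and a utility $\rho\in\mathbb R$ such that, with $X_i=\eta(i)A_i$: (a) $\eta(i)>0$ if and only if $i\le i^*$; (b) $\kappa_i=\bar c_K(X_i,\bar\mu_i)$ for $i\le i^*$, $\kappa_1<\dots<\kappa_{i^*}$, and $\kappa_i\ge\kappa_{i^*}$ for $i>i^*$; (c) if $K=2$, then $\kappa_i\ge d\delta$ for $i\le i^*$ (equivalently, the arrival time windows are intervals); (d) for all $i$ and all $h\in\mathcal H$, $h\big(\theta^O-\kappa_i-\sum_{j\le i}f_j\big)+(1-h)\theta^R-r_i\le\rho$, with equality for $h=\eta(i)$; (e) if $\mathcal H=[0,1]$, then $0<\eta(i^* )<1$ (location $i^*$ is the mixed zone). The equilibrium commuting cost $\lambda_i(\eta(i))$ is $\kappa_i$ for $i\le i^*$ and $0$ for $i>i^*$ (nobody commutes there). The total commuting cost is $TC=\sum_i\lambda_i(\eta(i))\,\eta(i)A_i$. Scenarios (all other parameters being the same), indicated by superscripts: (TLC) telecommuting: $\mathcal H=[0,1]$, $K=1$; (CS) combined scheme: $\mathcal H=[0,1]$, $K=2$. *)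

theory Defs
  imports Complex_Main
begin

text \<open>Locations are the naturals \<open>1, \<dots>, num_loc\<close>; values of the indexed fields at other
  indices are irrelevant, except for the convention \<open>capacity p (num_loc p + 1) = 0\<close>.
  Arriving \<open>x\<close> before (after) the preferred time costs \<open>early_cost * x\<close> (\<open>late_cost * x\<close>).
  The preferred times are \<open>pref_time 1\<close> and, if there are two, \<open>pref_time 2\<close>.\<close>

record city =
  num_loc :: nat
  land :: "nat \<Rightarrow> real"
  capacity :: "nat \<Rightarrow> real"
  free_flow :: "nat \<Rightarrow> real"
  wage_office :: real
  wage_remote :: real
  early_cost :: real
  late_cost :: real
  pref_time :: "nat \<Rightarrow> real"

definition cap_diff :: "city \<Rightarrow> nat \<Rightarrow> real" where
  "cap_diff p i = capacity p i - capacity p (i + 1)"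

definition delta :: "city \<Rightarrow> real" where
  "delta p = early_cost p * late_cost p / (early_cost p + late_cost p)"

definition time_gap :: "city \<Rightarrow> real" where
  "time_gap p = pref_time p 2 - pref_time p 1"

definition valid_city :: "city \<Rightarrow> bool" where
  "valid_city p \<longleftrightarrow>
     num_loc p \<ge> 1 \<and>
     (\<forall>i\<in>{1..num_loc p}. land p i > 0) \<and>
     (\<forall>i\<in>{1..<num_loc p}. capacity p i > capacity p (i + 1)) \<and>
     capacity p (num_loc p) > 0 \<and>
     capacity p (num_loc p + 1) = 0 \<and>
     (\<forall>i\<in>{1..num_loc p}. free_flow p i \<ge> 0) \<and>
     wage_office p > wage_remote p \<and>
     0 < early_cost p \<and> early_cost p < 1 \<and>
     0 < late_cost p \<and>
     (\<forall>i\<in>{1..<num_loc p}. late_cost p < cap_diff p i / capacity p (i + 1)) \<and>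
     time_gap p > 0"

text \<open>Short-term equilibrium commuting cost per trip, free-flow time excluded, when \<open>X > 0\<close>
  commuters with \<open>K\<close> preferred arrival times use a bottleneck of capacity \<open>m\<close>.\<close>

definition trip_cost :: "city \<Rightarrow> nat \<Rightarrow> real \<Rightarrow> real \<Rightarrow> real" where
  "trip_cost p K X m = X / m * delta p - time_gap p * (real K - 1) * delta p"

text \<open>A candidate long-term state: the last location \<open>last_office\<close> with office commuters
  (\<open>i\<^sup>*\<close> in the usual notation), office work ratios, land rents, commuting costs, and utility.\<close>

record state =
  last_office :: nat
  office_ratio :: "nat \<Rightarrow> real"
  rent :: "nat \<Rightarrow> real"
  cost :: "nat \<Rightarrow> real"
  utility :: real

definition commuters :: "city \<Rightarrow> state \<Rightarrow> nat \<Rightarrow> real" where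
  "commuters p e i = office_ratio e i * land p i"

text \<open>Utility of a worker at \<open>i\<close> who works in the office a fraction \<open>h\<close> of the days.\<close>

definition worker_utility :: "city \<Rightarrow> state \<Rightarrow> nat \<Rightarrow> real \<Rightarrow> real" where
  "worker_utility p e i h =
     h * (wage_office p - cost e i - (\<Sum>j=1..i. free_flow p j))
     + (1 - h) * wage_remote p - rent e i"

definition equilibrium :: "real set \<Rightarrow> nat \<Rightarrow> city \<Rightarrow> state \<Rightarrow> bool" where
  "equilibrium H K p e \<longleftrightarrow>
     H \<subseteq> {0..1} \<and> K \<in> {1, 2} \<and>
     last_office e \<in> {1..num_loc p} \<and>
     (\<forall>i\<in>{1..num_loc p}. office_ratio e i \<in> H \<and> rent e i \<ge> 0) \<and>
     rent e (num_loc p) = 0 \<and>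
     (\<forall>i\<in>{1..num_loc p}. office_ratio e i > 0 \<longleftrightarrow> i \<le> last_office e) \<and>
     (\<forall>i\<in>{1..last_office e}. cost e i = trip_cost p K (commuters p e i) (cap_diff p i)) \<and>
     strict_mono_on {1..last_office e} (cost e) \<and>
     (\<forall>i\<in>{last_office e<..num_loc p}. cost e i \<ge> cost e (last_office e)) \<and>
     (K = 2 \<longrightarrow> (\<forall>i\<in>{1..last_office e}. cost e i \<ge> time_gap p * delta p)) \<and>
     (\<forall>i\<in>{1..num_loc p}.
        (\<forall>h\<in>H. worker_utility p e i h \<le> utility e) \<and>
        worker_utility p e i (office_ratio e i) = utility e) \<and>
     (H = {0..1} \<longrightarrow> 0 < office_ratio e (last_office e) \<and> office_ratio e (last_office e) < 1)"

definition commuting_cost :: "state \<Rightarrow> nat \<Rightarrow> real" where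
  "commuting_cost e i = (if i \<le> last_office e then cost e i else 0)"

definition total_commuting_cost :: "city \<Rightarrow> state \<Rightarrow> real" where
  "total_commuting_cost p e =
     (\<Sum>i=1..num_loc p. commuting_cost e i * office_ratio e i * land p i)"

definition telecommuting_equilibrium :: "city \<Rightarrow> state \<Rightarrow> bool" where
  "telecommuting_equilibrium = equilibrium {0..1} 1"

definition combined_equilibrium :: "city \<Rightarrow> state \<Rightarrow> bool" where
  "combined_equilibrium = equilibrium {0..1} 2"

end

(* At a mixed zone the utility is affine in the office ratio and maximal at an interior point, so
   it is constant: office and remote work are equally good, which fixes the commuting cost there
   independently of the number of preferred arrival times. At the outermost location the rent
   vanishes and the ratio is either 0 or interior, hence the utility is the remote wage in every
   scenario. For the second claim one location suffices: both scenarios have the same cost per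
   trip, but spreading the arrivals allows more commuters at that cost. *)
theory Submission
  imports Defs
begin

lemma equilibrium_mixed_zone:
  assumes eq: "equilibrium {0..1} K p e" and i: "i \<in> {1..num_loc p}"
    and interior: "0 < office_ratio e i" "office_ratio e i < 1"
  shows "cost e i = wage_office p - wage_remote p - (\<Sum>j=1..i. free_flow p j)"
    and "utility e = wage_remote p - rent e i"
proof -
  define h where "h = office_ratio e i"
  \<comment> \<open>\<open>s\<close> is the net gain of an office day over a remote day at
    \<open>i\<close>, hence the slope of utility in the office ratio.\<close>
  define s where "s = wage_office p - cost e i - (\<Sum>j=1..i. free_flow p j) - wage_remote p"
  have affine: "worker_utility p e i x = x * s + wage_remote p - rent e i" for x
    by (simp add: worker_utility_def s_def algebra_simps)
  have opt: "worker_utility p e i h = utility e"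
    and le: "\<And>x. x \<in> {0..1} \<Longrightarrow> worker_utility p e i x \<le> utility e"
    using eq i unfolding equilibrium_def h_def by blast+
  \<comment> \<open>Deviating to fully remote work bounds the slope from below, deviating to full
    office work from above; as \<open>h\<close> is interior, both bounds apply to \<open>s\<close>
    itself.\<close>
  have "0 \<le> h * s" "(1 - h) * s \<le> 0"
    using opt le[of 0] le[of 1] by (simp_all add: affine algebra_simps)
  with interior have "s = 0"
    unfolding h_def by (simp add: zero_le_mult_iff mult_le_0_iff)
  with opt show "cost e i = wage_office p - wage_remote p - (\<Sum>j=1..i. free_flow p j)"
    and "utility e = wage_remote p - rent e i"
    by (simp_all add: affine) (simp add: s_def)
qed

lemma equilibrium_utility:
  assumes "equilibrium {0..1} K p e"
  shows "utility e = wage_remote p"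
proof -
  let ?n = "num_loc p"
  have n: "?n \<in> {1..num_loc p}" and last: "last_office e \<le> ?n" and rent: "rent e ?n = 0"
    using assms by (auto simp: equilibrium_def)
  show ?thesis
  proof (cases "last_office e = ?n")
    case True
    then have "0 < office_ratio e ?n" "office_ratio e ?n < 1"
      using assms by (auto simp: equilibrium_def)
    then show ?thesis
      using equilibrium_mixed_zone(2)[OF assms n] rent by simp
  next
    case False
    \<comment> \<open>Beyond \<open>last_office e\<close> the ratio is not positive, so it is
      exactly 0 and only the remote wage remains.\<close>
    with last have "\<not> ?n \<le> last_office e" by simp
    moreover have "office_ratio e ?n \<in> {0..1}"
      and "office_ratio e ?n > 0 \<longleftrightarrow> ?n \<le> last_office e"
      and "worker_utility p e ?n (office_ratio e ?n) = utility e"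
      using assms n unfolding equilibrium_def by blast+
    ultimately show ?thesis
      using rent by (auto simp: worker_utility_def)
  qed
qed

text \<open>The wage gap 1 without free-flow time pins the trip cost at 1. Land 10 exceeds the 4 or
  5 commuters this allows, so the location stays mixed.\<close>

definition one_location_city :: city where
  "one_location_city =
     \<lparr>num_loc = 1, land = (\<lambda>_. 10), capacity = (\<lambda>i. if i = 1 then 1 else 0),
      free_flow = (\<lambda>_. 0), wage_office = 1, wage_remote = 0,
      early_cost = 1/2, late_cost = 1/2, pref_time = real\<rparr>"

text \<open>With capacity 1, time gap 1 and \<delta> = 1/4, the equation X/4 - (K - 1)/4 = 1 gives X
  = 3 + K commuters.\<close>

definition one_location_state :: "nat \<Rightarrow> state" where
  "one_location_state K =
     \<lparr>last_office = 1, office_ratio = (\<lambda>_. (3 + real K) / 10), rent = (\<lambda>_. 0),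
      cost = (\<lambda>_. 1), utility = 0\<rparr>"

lemma one_location_city_simps:
  "num_loc one_location_city = 1" "land one_location_city i = 10"
  "cap_diff one_location_city 1 = 1" "delta one_location_city = 1/4"
  "time_gap one_location_city = 1"
  "wage_office one_location_city = 1" "wage_remote one_location_city = 0"
  "free_flow one_location_city i = 0"
  by (simp_all add: one_location_city_def cap_diff_def delta_def time_gap_def)

lemma valid_one_location_city: "valid_city one_location_city"
  by (simp add: valid_city_def one_location_city_def time_gap_def)

lemma one_location_equilibrium:
  assumes "K \<in> {1, 2}"
  shows "equilibrium {0..1} K one_location_city (one_location_state K)"
  using assms
  by (auto simp: equilibrium_def one_location_city_simps[unfolded One_nat_def]
      one_location_state_def trip_cost_def commuters_def worker_utility_def strict_mono_on_def
      field_simps)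

text \<open>Stated for an arbitrary equilibrium, since the costs are to be compared for every pair.
  The only location must be mixed, which fixes first the trip cost and then the number of
  commuters.\<close>

lemma one_location_total_cost:
  assumes eq: "equilibrium {0..1} K one_location_city e"
  shows "total_commuting_cost one_location_city e = 3 + real K"
proof -
  have last: "last_office e = 1"
    using eq by (auto simp: equilibrium_def one_location_city_simps)
  then have "0 < office_ratio e 1" "office_ratio e 1 < 1"
    and trip: "cost e 1 = trip_cost one_location_city K (commuters one_location_city e 1)
                 (cap_diff one_location_city 1)"
    using eq unfolding equilibrium_def by auto
  then have cost: "cost e 1 = 1"
    using equilibrium_mixed_zone(1)[OF eq, of 1] by (simp add: one_location_city_simps)
  with trip have "office_ratio e 1 * 10 = 3 + real K"
    unfolding trip_cost_def commuters_def one_location_city_simps by (simp add: field_simps)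
  with cost last show ?thesis
    by (simp add: total_commuting_cost_def commuting_cost_def one_location_city_simps)
qed

theorem theorem4:
  "(\<forall>p tlc cs. valid_city p \<longrightarrow> telecommuting_equilibrium p tlc \<longrightarrow> combined_equilibrium p cs \<longrightarrow>
      utility cs = utility tlc) \<and>
   (\<exists>p. valid_city p \<and>
      (\<exists>tlc. telecommuting_equilibrium p tlc) \<and>
      (\<exists>cs. combined_equilibrium p cs) \<and>
      (\<forall>tlc cs. telecommuting_equilibrium p tlc \<longrightarrow> combined_equilibrium p cs \<longrightarrow>
         total_commuting_cost p cs > total_commuting_cost p tlc))"
proof (intro conjI exI[of _ one_location_city] allI impI)
  fix p tlc cs
  assume "telecommuting_equilibrium p tlc" "combined_equilibrium p cs"
  then show "utility cs = utility tlc"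
    by (simp add: telecommuting_equilibrium_def combined_equilibrium_def equilibrium_utility)
next
  show "valid_city one_location_city" by (rule valid_one_location_city)
  \<comment> \<open>The explicit states keep the comparison of total costs from being
    vacuous.\<close>
  show "\<exists>tlc. telecommuting_equilibrium one_location_city tlc"
    unfolding telecommuting_equilibrium_def using one_location_equilibrium[of 1] by blast
  show "\<exists>cs. combined_equilibrium one_location_city cs"
    unfolding combined_equilibrium_def using one_location_equilibrium[of 2] by blast
next
  fix tlc cs
  assume "telecommuting_equilibrium one_location_city tlc"
    "combined_equilibrium one_location_city cs"
  then show "total_commuting_cost one_location_city cs > total_commuting_cost one_location_city tlc"
    by (simp add: telecommuting_equilibrium_def combined_equilibrium_def one_location_total_cost)
qed

end
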